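(* Let $k\ge 3$ and $t>2^{\lceil \log_2 k\rceil}$ be integers. Then $f_k(n,t)=\Omega(\sqrt{\log n})$.
   Context: Let $[n]=\{1,\dots,n\}$. A permutation $\rho$ of a finite set $X$ is a total order $<_\rho$ of the elements of $X$; if $Y\subseteq X$, then $\rho$ induces a permutation on $Y$ by restricting the order. For $t\ge 1$, a family $\mathcal{P}$ of permutations of $[n]$ $t$-shatters a set $X\subseteq[n]$ if the permutations of $\mathcal{P}$ induce at least $t$ distinct permutations on $X$. For $n \ge k$, $f_k(n,t)$ denotes the minimum number of permutations in a family of permutations of $[n]$ that $t$-shatters every subset of $[n]$ of size $k$ (interpreted as $+\infty$ if no such family exists, i.e. if $t>k!$). Asymptotic notation is for $k$ and $t$ fixed and $n\to\infty$; the implied constants may depend on $k$ and $t$. *)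

theory Defs
  imports "HOL-Library.Extended_Real" "HOL-Library.Landau_Symbols"
begin

text \<open>
  A permutation of \<open>X\<close> is a strict total order on \<open>X\<close>, given by its graph
  \<open>{(x, y). x < y}\<close>. The graph is required to lie inside \<open>X \<times> X\<close>, so that two
  permutations of \<open>X\<close> are equal as sets of pairs exactly if they order \<open>X\<close> alike.
\<close>

definition order_perms :: "'a set \<Rightarrow> 'a rel set" where
  "order_perms X = {r. r \<subseteq> X \<times> X \<and> strict_linear_order_on X r}"

definition induced_perm :: "'a set \<Rightarrow> 'a rel \<Rightarrow> 'a rel" where
  "induced_perm Y r = r \<inter> Y \<times> Y"

definition t_shatters :: "nat \<Rightarrow> 'a rel set \<Rightarrow> 'a set \<Rightarrow> bool" where
  "t_shatters t P X \<longleftrightarrow> t \<le> card (induced_perm X ` P)"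

definition shattering_families :: "nat \<Rightarrow> nat \<Rightarrow> nat \<Rightarrow> nat rel set set" where
  "shattering_families k n t =
     {P. P \<subseteq> order_perms {1..n} \<and> (\<forall>X. X \<subseteq> {1..n} \<and> card X = k \<longrightarrow> t_shatters t P X)}"

text \<open>
  The infimum over the empty set is \<open>\<infinity>\<close> in \<open>enat\<close>; otherwise it is attained.
  All families are finite, because \<open>{1..n}\<close> has only finitely many permutations.
\<close>

definition f_shatter :: "nat \<Rightarrow> nat \<Rightarrow> nat \<Rightarrow> enat" where
  "f_shatter k n t = (INF P \<in> shattering_families k n t. enat (card P))"

text \<open>
  The library's \<open>\<Omega>\<close> is for functions into a normed field; since \<open>f_shatter\<close> may be \<open>\<infinity>\<close>,
  its defining inequality is stated in the extended reals.
\<close>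

definition enat_bigomega :: "(nat \<Rightarrow> enat) \<Rightarrow> (nat \<Rightarrow> real) \<Rightarrow> bool" where
  "enat_bigomega h g \<longleftrightarrow>
     (\<exists>c>0. \<forall>\<^sub>F n in sequentially. ereal (c * \<bar>g n\<bar>) \<le> ereal_of_enat (h n))"

lemma enat_bigomega_enat_iff:
  "enat_bigomega (\<lambda>n. enat (h n)) g \<longleftrightarrow> (\<lambda>n. real (h n)) \<in> \<Omega>(g)"
  by (simp add: enat_bigomega_def bigomega_def)

end

theory Submission
  imports Defs "HOL-Library.FuncSet"
begin

text \<open>
  Put \<open>d = \<lceil>log\<^sub>2 k\<rceil>\<close>. The leaves of a complete binary tree of depth \<open>d\<close>, drawn in the plane,
  are ordered from left to right; reversing the two children at every node of a level, for any
  choice of levels, gives only \<open>2 ^ d\<close> orders of the \<open>2 ^ d\<close> leaves. If the points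
  can be arranged as such leaves in a way that every permutation of the family induces one of these
  orders, then the family induces at most \<open>2 ^ d < t\<close> orders on the leaves, and hence on
  any \<open>k\<close> of them. So it is enough to find such a tree inside \<open>{1..n}\<close> whenever the number \<open>m\<close>
  of permutations is small compared with \<open>sqrt (ln n)\<close>.

  The tree is built by recursion on \<open>d\<close> (lemma \<open>flip_tree_exists\<close>). By repeated halving, a large set
  contains \<open>2 ^ (d * m + 1)\<close> large subsets any two of which are separated in every
  permutation: one lies entirely before the other (lemma \<open>separated_family\<close>). Each of these subsets
  contains a tree of depth \<open>d\<close>, on which each of the \<open>m\<close> permutations induces one of \<open>2 ^ d\<close>
  flip orders. There are at most \<open>2 ^ (d * m)\<close> ways of doing so, and therefore two of the trees
  are ordered alike by every permutation. Since they are separated, they are the two halves of a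
  tree of depth \<open>d + 1\<close>.

  One step of the recursion costs a factor \<open>2 ^ ((m + 1) * (d * m + 1))\<close> in the number of points, so
  \<open>2 ^ O(m\<^sup>2)\<close> points suffice, and a family that \<open>t\<close>-shatters all \<open>k\<close>-sets has
  \<open>n < 2 ^ O(m\<^sup>2)\<close>.
\<close>

section \<open>Separated sets\<close>

definition separated :: "'a rel \<Rightarrow> 'a set \<Rightarrow> 'a set \<Rightarrow> bool" where
  "separated r A B \<longleftrightarrow> A \<times> B \<subseteq> r \<or> B \<times> A \<subseteq> r"

lemma separated_commute: "separated r A B \<longleftrightarrow> separated r B A"
  by (auto simp: separated_def)

lemma separated_mono: "separated r A B \<Longrightarrow> A' \<subseteq> A \<Longrightarrow> B' \<subseteq> B \<Longrightarrow> separated r A' B'"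
  unfolding separated_def by blast

lemma strict_linear_order_on_minimum:
  assumes "strict_linear_order_on V r" "finite A" "A \<noteq> {}" "A \<subseteq> V"
  shows "\<exists>a\<in>A. {a} \<times> (A - {a}) \<subseteq> r"
  using assms(2-4)
proof (induction A rule: finite_ne_induct)
  case (insert x F)
  then obtain a where a: "a \<in> F" "{a} \<times> (F - {a}) \<subseteq> r" by auto
  have "(a, x) \<in> r \<or> (x, a) \<in> r" and trans: "trans r"
    using assms(1) insert.prems insert.hyps a(1)
    by (auto simp: strict_linear_order_on_def total_on_def)
  then show ?case
  proof (elim disjE)
    assume "(x, a) \<in> r"
    then have "{x} \<times> (insert x F - {x}) \<subseteq> r" using a transD[OF trans] by blast
    then show ?thesis by blast
  qed (use a in blast)
qed auto

lemma strict_linear_order_on_initial_segment: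
  assumes "strict_linear_order_on V r" "finite A" "A \<subseteq> V" "x \<le> card A"
  shows "\<exists>I\<subseteq>A. card I = x \<and> I \<times> (A - I) \<subseteq> r"
  using assms(4)
proof (induction x)
  case 0
  show ?case by (intro exI[of _ "{}"]) auto
next
  case (Suc x)
  then obtain I where I: "I \<subseteq> A" "card I = x" "I \<times> (A - I) \<subseteq> r" by auto
  have "A - I \<noteq> {}" using Suc.prems I by auto
  then obtain a where a: "a \<in> A - I" "{a} \<times> (A - I - {a}) \<subseteq> r"
    using strict_linear_order_on_minimum[of V r "A - I"] assms by blast
  have "card (insert a I) = Suc x"
    using a I assms(2) finite_subset[OF I(1)] by auto
  moreover have "insert a I \<times> (A - insert a I) \<subseteq> r" "insert a I \<subseteq> A" using a I by auto
  ultimately show ?case by blast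
qed

text \<open>
  Cut both sets after their first \<open>x\<close> elements. If the first half of \<open>A\<close> does not precede the second half of \<open>B\<close>, then some point of the second
  half of \<open>B\<close> precedes a point of the first half of \<open>A\<close>, and this pair forces the first half of \<open>B\<close> to
  precede the second half of \<open>A\<close>.
\<close>

lemma separate_halves:
  assumes r: "strict_linear_order_on V r"
    and A: "finite A" "A \<subseteq> V" "2 * x \<le> card A"
    and B: "finite B" "B \<subseteq> V" "2 * x \<le> card B"
    and "disjnt A B"
  shows "\<exists>A' B'. A' \<subseteq> A \<and> B' \<subseteq> B \<and> x \<le> card A' \<and> x \<le> card B' \<and> separated r A' B'"
proof -
  obtain I where I: "I \<subseteq> A" "card I = x" "I \<times> (A - I) \<subseteq> r"
    using strict_linear_order_on_initial_segment[OF r A(1,2), of x] A(3) by auto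
  obtain J where J: "J \<subseteq> B" "card J = x" "J \<times> (B - J) \<subseteq> r"
    using strict_linear_order_on_initial_segment[OF r B(1,2), of x] B(3) by auto
  have card: "x \<le> card (A - I)" "x \<le> card (B - J)"
    using I J A B by (auto simp: card_Diff_subset finite_subset)
  have "I \<times> (B - J) \<subseteq> r \<or> J \<times> (A - I) \<subseteq> r"
  proof (rule disjCI)
    assume "\<not> J \<times> (A - I) \<subseteq> r"
    then obtain b a where ba: "b \<in> J" "a \<in> A - I" "(b, a) \<notin> r" by auto
    have trans: "trans r" and total: "total_on V r"
      using r by (auto simp: strict_linear_order_on_def)
    have "a \<in> V" "b \<in> V" "a \<noteq> b"
      using ba J(1) A(2) B(2) \<open>disjnt A B\<close> by (auto simp: disjnt_iff)
    then have "(a, b) \<in> r" using total ba(3) by (auto simp: total_on_def)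
    then show "I \<times> (B - J) \<subseteq> r"
      using ba I(3) J(3) transD[OF trans] by blast
  qed
  then show ?thesis
  proof
    assume "I \<times> (B - J) \<subseteq> r"
    then show ?thesis using I(1,2) card
      by (intro exI[of _ I] exI[of _ "B - J"]) (auto simp: separated_def)
  next
    assume "J \<times> (A - I) \<subseteq> r"
    then show ?thesis using J(1,2) card
      by (intro exI[of _ "A - I"] exI[of _ J]) (auto simp: separated_def)
  qed
qed

lemma separate_in_all:
  assumes "finite P" "\<And>r. r \<in> P \<Longrightarrow> strict_linear_order_on V r"
    and "finite A" "A \<subseteq> V" "2 ^ card P * x \<le> card A"
    and "finite B" "B \<subseteq> V" "2 ^ card P * x \<le> card B"
    and "disjnt A B"
  shows "\<exists>A' B'. A' \<subseteq> A \<and> B' \<subseteq> B \<and> x \<le> card A' \<and> x \<le> card B' \<and> (\<forall>r\<in>P. separated r A' B')"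
  using assms
proof (induction P arbitrary: A B rule: finite_induct)
  case empty
  then show ?case by auto
next
  case (insert r P)
  have size: "2 * (2 ^ card P * x) \<le> card A" "2 * (2 ^ card P * x) \<le> card B"
    using insert by (auto simp: mult.assoc)
  obtain A1 B1 where 1: "A1 \<subseteq> A" "B1 \<subseteq> B" "2 ^ card P * x \<le> card A1"
      "2 ^ card P * x \<le> card B1" "separated r A1 B1"
    using separate_halves[OF insert.prems(1)[OF insertI1] insert.prems(2,3) size(1) insert.prems(5,6)
        size(2) insert.prems(8)] by auto
  have "\<exists>A' B'. A' \<subseteq> A1 \<and> B' \<subseteq> B1 \<and> x \<le> card A' \<and> x \<le> card B' \<and> (\<forall>r\<in>P. separated r A' B')"
  proof (rule insert.IH)
    show "finite A1" "finite B1" "A1 \<subseteq> V" "B1 \<subseteq> V"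
      using 1(1,2) insert.prems finite_subset by blast+
    show "disjnt A1 B1" using 1(1,2) insert.prems(8) by (auto simp: disjnt_iff)
  qed (use 1 insert.prems in auto)
  then obtain A' B' where 2: "A' \<subseteq> A1" "B' \<subseteq> B1" "x \<le> card A'" "x \<le> card B'"
      "\<forall>r\<in>P. separated r A' B'" by auto
  then have "separated r A' B'" using separated_mono[OF 1(5)] by blast
  with 1 2 show ?case by (intro exI[of _ A'] exI[of _ B']) auto
qed

text \<open>
  Splitting a set into two halves and separating these costs a factor \<open>2 ^ (card P + 1)\<close>; after \<open>q\<close>
  rounds of doing this to all the pieces there are \<open>2 ^ q\<close> of them.
\<close>

lemma separated_family:
  assumes P: "finite P" "\<And>r. r \<in> P \<Longrightarrow> strict_linear_order_on V r"
    and "x > 0" "finite S" "S \<subseteq> V" "2 ^ ((card P + 1) * q) * x \<le> card S"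
  shows "\<exists>\<C>. card \<C> = 2 ^ q \<and> (\<forall>C\<in>\<C>. C \<subseteq> S \<and> x \<le> card C) \<and>
    pairwise (\<lambda>C D. disjnt C D \<and> (\<forall>r\<in>P. separated r C D)) \<C>"
  using assms(4-6)
proof (induction q arbitrary: S)
  case 0
  then show ?case by (intro exI[of _ "{S}"]) (auto simp: pairwise_def)
next
  case (Suc q)
  let ?N = "2 ^ ((card P + 1) * q) * x"
  have size: "2 * (2 ^ card P * ?N) \<le> card S"
    using Suc.prems(3) by (simp add: power_add mult_ac)
  then obtain A where A: "A \<subseteq> S" "card A = 2 ^ card P * ?N"
    using obtain_subset_with_card_n[of "2 ^ card P * ?N" S] by auto
  define B where "B = S - A"
  have fin: "finite A" "finite B" "A \<subseteq> V" "B \<subseteq> V"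
    using A(1) Suc.prems(1,2) finite_subset unfolding B_def by blast+
  have B: "2 ^ card P * ?N \<le> card B"
    using size A fin(1) unfolding B_def by (simp add: card_Diff_subset)
  have "disjnt A B" by (auto simp: B_def disjnt_iff)
  then obtain A' B' where sub: "A' \<subseteq> A" "B' \<subseteq> B" and card: "?N \<le> card A'" "?N \<le> card B'"
      and sep: "\<forall>r\<in>P. separated r A' B'"
    using separate_in_all[OF P fin(1,3) _ fin(2,4) B] A(2) by (metis order_refl)
  have fin': "finite A'" "finite B'" "A' \<subseteq> V" "B' \<subseteq> V"
    using sub fin finite_subset by blast+
  have disj: "disjnt A' B'" using sub \<open>disjnt A B\<close> by (auto simp: disjnt_iff)
  obtain \<A> where \<A>: "card \<A> = 2 ^ q" "\<forall>C\<in>\<A>. C \<subseteq> A' \<and> x \<le> card C"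
      "pairwise (\<lambda>C D. disjnt C D \<and> (\<forall>r\<in>P. separated r C D)) \<A>"
    using Suc.IH[OF fin'(1,3) card(1)] by auto
  obtain \<B> where \<B>: "card \<B> = 2 ^ q" "\<forall>C\<in>\<B>. C \<subseteq> B' \<and> x \<le> card C"
      "pairwise (\<lambda>C D. disjnt C D \<and> (\<forall>r\<in>P. separated r C D)) \<B>"
    using Suc.IH[OF fin'(2,4) card(2)] by auto
  have cross: "disjnt C D \<and> (\<forall>r\<in>P. separated r C D)" if "C \<in> \<A>" "D \<in> \<B>" for C D
  proof -
    have "C \<subseteq> A'" "D \<subseteq> B'" using that \<A>(2) \<B>(2) by auto
    then show ?thesis using disj sep separated_mono unfolding disjnt_iff by blast
  qed
  \<comment> \<open>The members are nonempty since \<open>x > 0\<close>, so no set occurs in both families.\<close>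
  have "\<A> \<inter> \<B> = {}"
  proof (rule ccontr)
    assume "\<A> \<inter> \<B> \<noteq> {}"
    then obtain C where C: "C \<in> \<A>" "C \<in> \<B>" by auto
    then have "C = {}" using cross by (auto simp: disjnt_iff)
    then show False using C(1) \<A>(2) \<open>x > 0\<close> by auto
  qed
  moreover have "finite \<A>" "finite \<B>" using \<A>(1) \<B>(1) by (auto intro: card_ge_0_finite)
  ultimately have "card (\<A> \<union> \<B>) = 2 ^ Suc q"
    using \<A>(1) \<B>(1) by (simp add: card_Un_disjoint)
  moreover have "\<forall>C\<in>\<A> \<union> \<B>. C \<subseteq> S \<and> x \<le> card C"
  proof -
    have "A' \<subseteq> S" "B' \<subseteq> S" using sub A(1) by (auto simp: B_def)
    then show ?thesis using \<A>(2) \<B>(2) by blast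
  qed
  moreover have "pairwise (\<lambda>C D. disjnt C D \<and> (\<forall>r\<in>P. separated r C D)) (\<A> \<union> \<B>)"
  proof (rule pairwiseI)
    fix C D assume CD: "C \<in> \<A> \<union> \<B>" "D \<in> \<A> \<union> \<B>" "C \<noteq> D"
    then consider "C \<in> \<A>" "D \<in> \<A>" | "C \<in> \<B>" "D \<in> \<B>" | "C \<in> \<A>" "D \<in> \<B>" | "D \<in> \<A>" "C \<in> \<B>"
      by blast
    then show "disjnt C D \<and> (\<forall>r\<in>P. separated r C D)"
    proof cases
      case 4
      then show ?thesis using cross[of D C] by (simp add: disjnt_sym separated_commute)
    qed (use CD(3) \<A>(3) \<B>(3) cross in \<open>auto simp: pairwise_def\<close>)
  qed
  ultimately show ?case by blast
qed

section \<open>Flip orders of the leaves of a binary tree\<close>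

text \<open>
  The leaves of the tree of depth \<open>d\<close> are the numbers below \<open>2 ^ d\<close>; the two subtrees of the root
  have the leaves below \<open>2 ^ (d - 1)\<close> and the remaining ones. Both subtrees carry the same order \<open>R\<close>,
  because a level is flipped as a whole.
\<close>

definition two_copies :: "nat \<Rightarrow> nat rel \<Rightarrow> nat rel" where
  "two_copies d R = R \<union> map_prod ((+) (2 ^ d)) ((+) (2 ^ d)) ` R"

fun flip_orders :: "nat \<Rightarrow> nat rel set" where
  "flip_orders 0 = {{}}"
| "flip_orders (Suc d) =
     (\<lambda>R. two_copies d R \<union> {..<2 ^ d} \<times> {2 ^ d..<2 ^ Suc d}) ` flip_orders d \<union>
     (\<lambda>R. two_copies d R \<union> {2 ^ d..<2 ^ Suc d} \<times> {..<2 ^ d}) ` flip_orders d"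

lemma finite_flip_orders: "finite (flip_orders d)"
  by (induction d) auto

lemma card_flip_orders_le: "card (flip_orders d) \<le> 2 ^ d"
proof (induction d)
  case (Suc d)
  have "card (flip_orders (Suc d)) \<le> card (flip_orders d) + card (flip_orders d)"
    unfolding flip_orders.simps
    by (intro order_trans[OF card_Un_le] add_mono card_image_le finite_flip_orders)
  with Suc show ?case by simp
qed auto

definition pattern :: "nat \<Rightarrow> (nat \<Rightarrow> 'a) \<Rightarrow> 'a rel \<Rightarrow> nat rel" where
  "pattern d f r = {(a, b). a < 2 ^ d \<and> b < 2 ^ d \<and> (f a, f b) \<in> r}"

lemma induced_perm_eq_image_pattern:
  "induced_perm (f ` {..<2 ^ d}) r = map_prod f f ` pattern d f r"
  by (auto simp: induced_perm_def pattern_def image_iff)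

definition join_leaves :: "nat \<Rightarrow> (nat \<Rightarrow> 'a) \<Rightarrow> (nat \<Rightarrow> 'a) \<Rightarrow> nat \<Rightarrow> 'a" where
  "join_leaves d f g a = (if a < 2 ^ d then f a else g (a - 2 ^ d))"

lemma join_leaves_image_subset:
  assumes "f ` {..<2 ^ d} \<subseteq> S" "g ` {..<2 ^ d} \<subseteq> S"
  shows "join_leaves d f g ` {..<2 ^ Suc d} \<subseteq> S"
proof (intro image_subsetI)
  fix a :: nat assume "a \<in> {..<2 ^ Suc d}"
  then have "a < 2 ^ d \<or> a - 2 ^ d < 2 ^ d" by auto
  then show "join_leaves d f g a \<in> S" using assms by (auto simp: join_leaves_def)
qed

lemma inj_on_join_leaves:
  assumes "inj_on f {..<2 ^ d}" "inj_on g {..<2 ^ d}"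
    and "f ` {..<2 ^ d} \<subseteq> A" "g ` {..<2 ^ d} \<subseteq> B" "disjnt A B"
  shows "inj_on (join_leaves d f g) {..<2 ^ Suc d}"
proof (rule inj_onI)
  fix a b :: nat
  assume ab: "a \<in> {..<2 ^ Suc d}" "b \<in> {..<2 ^ Suc d}"
    and eq: "join_leaves d f g a = join_leaves d f g b"
  have f: "f x \<in> A" if "x < 2 ^ d" for x using assms(3) that by auto
  have g: "g (x - 2 ^ d) \<in> B" if "x < 2 ^ Suc d" "\<not> x < 2 ^ d" for x
    using assms(4) that by auto
  show "a = b"
  proof (cases "a < 2 ^ d")
    case True
    moreover have "b < 2 ^ d"
      using True ab eq f[of a] g[of b] \<open>disjnt A B\<close>
      by (auto simp: join_leaves_def disjnt_iff split: if_splits)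
    ultimately show ?thesis using eq inj_onD[OF assms(1)] by (auto simp: join_leaves_def)
  next
    case False
    moreover have "\<not> b < 2 ^ d"
      using False ab eq f[of b] g[of a] \<open>disjnt A B\<close>
      by (auto simp: join_leaves_def disjnt_iff split: if_splits)
    ultimately have "a - 2 ^ d = b - 2 ^ d"
      using eq ab inj_onD[OF assms(2), of "a - 2 ^ d" "b - 2 ^ d"]
      by (auto simp: join_leaves_def)
    then show ?thesis using False \<open>\<not> b < 2 ^ d\<close> by simp
  qed
qed

text \<open>
  Two separated trees with the same pattern are the subtrees of a tree whose root is
  flipped or not according to which of the two comes first.
\<close>

lemma pattern_join_leaves:
  assumes r: "strict_linear_order_on V r"
    and R: "pattern d f r \<in> flip_orders d" "pattern d g r = pattern d f r"
    and f: "f ` {..<2 ^ d} \<subseteq> A" and g: "g ` {..<2 ^ d} \<subseteq> B"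
    and sep: "separated r A B"
  shows "pattern (Suc d) (join_leaves d f g) r \<in> flip_orders (Suc d)"
proof -
  let ?j = "join_leaves d f g"
  let ?L = "{..<2 ^ d :: nat}" and ?U = "{2 ^ d..<2 ^ Suc d :: nat}"
  have asym: "(y, x) \<notin> r" if "(x, y) \<in> r" for x y
    using r that unfolding strict_linear_order_on_def irrefl_def by (meson transD)
  have mem: "(a, b) \<in> two_copies d (pattern d f r) \<longleftrightarrow>
      (a, b) \<in> pattern (Suc d) ?j r \<and> (a < 2 ^ d \<longleftrightarrow> b < 2 ^ d)" for a b
  proof -
    have "(a, b) \<in> map_prod ((+) (2 ^ d)) ((+) (2 ^ d)) ` pattern d g r \<longleftrightarrow>
        a \<ge> 2 ^ d \<and> b \<ge> 2 ^ d \<and> (a, b) \<in> pattern (Suc d) ?j r"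
    proof
      assume "a \<ge> 2 ^ d \<and> b \<ge> 2 ^ d \<and> (a, b) \<in> pattern (Suc d) ?j r"
      then have "(a - 2 ^ d, b - 2 ^ d) \<in> pattern d g r"
        and "(a, b) = map_prod ((+) (2 ^ d)) ((+) (2 ^ d)) (a - 2 ^ d, b - 2 ^ d)"
        by (auto simp: pattern_def join_leaves_def)
      then show "(a, b) \<in> map_prod ((+) (2 ^ d)) ((+) (2 ^ d)) ` pattern d g r"
        by (metis image_eqI)
    qed (auto simp: pattern_def join_leaves_def)
    moreover have "(a, b) \<in> pattern d f r \<longleftrightarrow>
        a < 2 ^ d \<and> b < 2 ^ d \<and> (a, b) \<in> pattern (Suc d) ?j r"
      by (auto simp: pattern_def join_leaves_def)
    ultimately show ?thesis unfolding two_copies_def R(2) by auto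
  qed
  have jL: "?j a \<in> A" if "a \<in> ?L" for a using that f by (auto simp: join_leaves_def)
  have jU: "?j a \<in> B" if "a \<in> ?U" for a using that g by (auto simp: join_leaves_def)
  have bound: "a < 2 ^ Suc d \<and> b < 2 ^ Suc d" if "(a, b) \<in> pattern (Suc d) ?j r" for a b
    using that by (auto simp: pattern_def)
  from sep consider "A \<times> B \<subseteq> r" | "B \<times> A \<subseteq> r" by (auto simp: separated_def)
  then show ?thesis
  proof cases
    case 1
    have "pattern (Suc d) ?j r = two_copies d (pattern d f r) \<union> ?L \<times> ?U"
    proof (intro set_eqI, clarify)
      fix a b
      have 2: "(a, b) \<in> pattern (Suc d) ?j r" if "a \<in> ?L" "b \<in> ?U"
        using that 1 jL[OF that(1)] jU[OF that(2)] by (auto simp: pattern_def)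
      have 3: "(a, b) \<notin> pattern (Suc d) ?j r" if "a \<in> ?U" "b \<in> ?L"
        using that 1 jL[OF that(2)] jU[OF that(1)] asym by (auto simp: pattern_def)
      show "(a, b) \<in> pattern (Suc d) ?j r \<longleftrightarrow>
          (a, b) \<in> two_copies d (pattern d f r) \<union> ?L \<times> ?U"
        using mem[of a b] 2 3 bound[of a b] by (auto simp: not_less)
    qed
    then show ?thesis using R(1) by auto
  next
    case 2
    have "pattern (Suc d) ?j r = two_copies d (pattern d f r) \<union> ?U \<times> ?L"
    proof (intro set_eqI, clarify)
      fix a b
      have 3: "(a, b) \<in> pattern (Suc d) ?j r" if "a \<in> ?U" "b \<in> ?L"
        using that 2 jL[OF that(2)] jU[OF that(1)] by (auto simp: pattern_def)
      have 4: "(a, b) \<notin> pattern (Suc d) ?j r" if "a \<in> ?L" "b \<in> ?U"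
        using that 2 jL[OF that(1)] jU[OF that(2)] asym by (auto simp: pattern_def)
      show "(a, b) \<in> pattern (Suc d) ?j r \<longleftrightarrow>
          (a, b) \<in> two_copies d (pattern d f r) \<union> ?U \<times> ?L"
        using mem[of a b] 3 4 bound[of a b] by (auto simp: not_less)
    qed
    then show ?thesis using R(1) by auto
  qed
qed

section \<open>Large sets contain flip trees\<close>

text \<open>
  The exponent is a crude bound: the recursion uses the factors
  \<open>2 ^ ((card P + 1) * (i * card P + 1))\<close> for \<open>i < d\<close>, and each of them is bounded by the factor
  for \<open>i = d\<close>.
\<close>

lemma flip_tree_exists:
  assumes P: "finite P" "\<And>r. r \<in> P \<Longrightarrow> strict_linear_order_on V r"
    and "finite S" "S \<subseteq> V" "2 ^ (d * ((card P + 1) * (d * card P + 1))) \<le> card S"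
  shows "\<exists>f. inj_on f {..<2 ^ d} \<and> f ` {..<2 ^ d} \<subseteq> S \<and> (\<forall>r\<in>P. pattern d f r \<in> flip_orders d)"
  using assms(3-5)
proof (induction d arbitrary: S)
  case 0
  then obtain s where "s \<in> S" by fastforce
  moreover have "(s, s) \<notin> r" if "r \<in> P" for r
    using P(2)[OF that] by (auto simp: strict_linear_order_on_def irrefl_def)
  ultimately show ?case by (intro exI[of _ "\<lambda>_. s"]) (auto simp: pattern_def inj_on_def)
next
  case (Suc d)
  let ?m = "card P"
  let ?x = "2 ^ (d * ((?m + 1) * (d * ?m + 1))) :: nat"
  let ?q = "d * ?m + 1"
  have "(?m + 1) * ?q + d * ((?m + 1) * ?q) \<le> Suc d * ((?m + 1) * (Suc d * ?m + 1))"
  proof -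
    have "Suc d * ((?m + 1) * ?q) \<le> Suc d * ((?m + 1) * (Suc d * ?m + 1))"
      by (intro mult_le_mono2) simp
    then show ?thesis by simp
  qed
  then have "2 ^ ((?m + 1) * ?q) * ?x \<le> 2 ^ (Suc d * ((?m + 1) * (Suc d * ?m + 1)))"
    unfolding power_add[symmetric] by (intro power_increasing) auto
  also note Suc.prems(3)
  finally obtain \<C> where \<C>: "card \<C> = 2 ^ ?q" "\<forall>C\<in>\<C>. C \<subseteq> S \<and> ?x \<le> card C"
      "pairwise (\<lambda>C D. disjnt C D \<and> (\<forall>r\<in>P. separated r C D)) \<C>"
    using separated_family[OF P, of ?x S ?q] Suc.prems(1,2) by auto
  have "\<forall>C\<in>\<C>. \<exists>f. inj_on f {..<2 ^ d} \<and> f ` {..<2 ^ d} \<subseteq> C \<and>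
      (\<forall>r\<in>P. pattern d f r \<in> flip_orders d)"
  proof
    fix C assume "C \<in> \<C>"
    then have C: "C \<subseteq> S" "?x \<le> card C" using \<C>(2) by auto
    show "\<exists>f. inj_on f {..<2 ^ d} \<and> f ` {..<2 ^ d} \<subseteq> C \<and> (\<forall>r\<in>P. pattern d f r \<in> flip_orders d)"
      using C Suc.prems finite_subset by (intro Suc.IH) auto
  qed
  then obtain F where F: "inj_on (F C) {..<2 ^ d}" "F C ` {..<2 ^ d} \<subseteq> C"
      "\<forall>r\<in>P. pattern d (F C) r \<in> flip_orders d" if "C \<in> \<C>" for C
    by metis
  \<comment> \<open>There are at most \<open>2 ^ (d * ?m)\<close> values of \<open>\<tau>\<close>; the summand 1 in \<open>?q\<close> makes \<open>\<C>\<close> larger than that.\<close>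
  define \<tau> where "\<tau> C = restrict (pattern d (F C)) P" for C
  have "\<tau> ` \<C> \<subseteq> P \<rightarrow>\<^sub>E flip_orders d"
    using F(3) by (auto simp: \<tau>_def)
  then have "card (\<tau> ` \<C>) \<le> card (P \<rightarrow>\<^sub>E flip_orders d)"
    by (intro card_mono finite_PiE P finite_flip_orders)
  also have "\<dots> = card (flip_orders d) ^ ?m" using P(1) by (simp add: card_PiE)
  also have "\<dots> \<le> (2 ^ d) ^ ?m" by (intro power_mono card_flip_orders_le) simp
  also have "\<dots> < card \<C>" unfolding \<C>(1) by (simp add: power_mult)
  finally have "\<not> inj_on \<tau> \<C>" by (rule pigeonhole)
  then obtain C D where CD: "C \<in> \<C>" "D \<in> \<C>" "C \<noteq> D" "\<tau> C = \<tau> D"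
    by (auto simp: inj_on_def)
  have same: "pattern d (F D) r = pattern d (F C) r" if "r \<in> P" for r
    using fun_cong[OF CD(4), of r] that by (simp add: \<tau>_def)
  have sep: "disjnt C D" "\<forall>r\<in>P. separated r C D"
    using \<C>(3) CD(1-3) by (auto simp: pairwise_def)
  let ?j = "join_leaves d (F C) (F D)"
  have "inj_on ?j {..<2 ^ Suc d}"
    using inj_on_join_leaves[OF F(1)[OF CD(1)] F(1)[OF CD(2)] F(2)[OF CD(1)] F(2)[OF CD(2)] sep(1)] .
  moreover have "?j ` {..<2 ^ Suc d} \<subseteq> S"
    using F(2)[OF CD(1)] F(2)[OF CD(2)] \<C>(2) CD(1,2) by (intro join_leaves_image_subset) blast+
  moreover have "pattern (Suc d) ?j r \<in> flip_orders (Suc d)" if "r \<in> P" for r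
    using pattern_join_leaves[OF P(2)[OF that] _ same[OF that] F(2)[OF CD(1)] F(2)[OF CD(2)]]
      F(3)[OF CD(1)] sep(2) that by blast
  ultimately show ?case by blast
qed

section \<open>The lower bound\<close>

lemma card_induced_perm_mono:
  assumes "finite P" "Y \<subseteq> X"
  shows "card (induced_perm Y ` P) \<le> card (induced_perm X ` P)"
proof -
  have "induced_perm Y ` P = induced_perm Y ` induced_perm X ` P"
    using assms(2) by (auto simp: induced_perm_def image_image Int_absorb1 Int_assoc
        Sigma_mono intro!: image_cong)
  then show ?thesis using assms(1) by (metis card_image_le finite_imageI)
qed

text \<open>
  An order induced on the leaves of a flip tree is determined by its pattern, and hence so is the order
  induced on any \<open>k\<close> of the leaves.
\<close>

lemma few_induced_perms:
  assumes P: "finite P" "\<And>r. r \<in> P \<Longrightarrow> strict_linear_order_on S r"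
    and S: "finite S" "2 ^ (d * ((card P + 1) * (d * card P + 1))) \<le> card S"
    and "k \<le> 2 ^ d"
  shows "\<exists>X\<subseteq>S. card X = k \<and> card (induced_perm X ` P) \<le> 2 ^ d"
proof -
  obtain f where f: "inj_on f {..<2 ^ d}" "f ` {..<2 ^ d} \<subseteq> S"
      "\<forall>r\<in>P. pattern d f r \<in> flip_orders d"
    using flip_tree_exists[OF P S(1) order_refl S(2)] by auto
  let ?T = "f ` {..<2 ^ d}"
  have "card ?T = 2 ^ d" using f(1) by (simp add: card_image)
  then obtain X where X: "X \<subseteq> ?T" "card X = k"
    using obtain_subset_with_card_n[of k ?T] \<open>k \<le> 2 ^ d\<close> by auto
  have "induced_perm ?T ` P \<subseteq> (\<lambda>R. map_prod f f ` R) ` flip_orders d"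
    using f(3) by (auto simp: induced_perm_eq_image_pattern)
  then have "card (induced_perm ?T ` P) \<le> card (flip_orders d)"
    using finite_flip_orders by (rule surj_card_le[rotated])
  with card_induced_perm_mono[OF P(1) X(1)] card_flip_orders_le[of d]
  have "card (induced_perm X ` P) \<le> 2 ^ d" by linarith
  then show ?thesis using X f(2) by blast
qed

text \<open>
  By the previous lemma \<open>n < 2 ^ E\<close> for an exponent \<open>E\<close> that is quadratic in the number \<open>m\<close> of
  permutations. The family is nonempty, so \<open>m + 1 \<le> 2 * m\<close> and \<open>d * m + 1 \<le> (d + 1) * m\<close>, which
  gives \<open>E \<le> (2 * (d + 1) * m)\<^sup>2\<close>.
\<close>

lemma shattering_family_bound:
  assumes P: "P \<in> shattering_families k n t"
    and "k \<le> 2 ^ d" "2 ^ d < t" "k \<le> n" "0 < n"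
  shows "sqrt (ln (real n)) \<le> 2 * (d + 1) * card P"
proof -
  let ?m = "card P"
  let ?E = "d * ((?m + 1) * (d * ?m + 1))"
  have sub: "P \<subseteq> Pow ({1..n} \<times> {1..n})"
    and lin: "\<And>r. r \<in> P \<Longrightarrow> strict_linear_order_on {1..n} r"
    and shatter: "\<And>X. X \<subseteq> {1..n} \<Longrightarrow> card X = k \<Longrightarrow> t \<le> card (induced_perm X ` P)"
    using P by (auto simp: shattering_families_def order_perms_def t_shatters_def)
  have fin: "finite P" by (rule finite_subset[OF sub]) simp
  have "?m > 0"
  proof -
    have "card {1..k} = k" "{1..k} \<subseteq> {1..n}" using \<open>k \<le> n\<close> by auto
    then have "P \<noteq> {}" using shatter[of "{1..k}"] \<open>2 ^ d < t\<close> by auto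
    then show ?thesis using fin by (simp add: card_gt_0_iff)
  qed
  have "n < 2 ^ ?E"
  proof (rule ccontr)
    assume "\<not> n < 2 ^ ?E"
    then obtain X where "X \<subseteq> {1..n}" "card X = k" "card (induced_perm X ` P) \<le> 2 ^ d"
      using few_induced_perms[OF fin lin, of d k] \<open>k \<le> 2 ^ d\<close> by auto
    then show False using shatter[of X] \<open>2 ^ d < t\<close> by simp
  qed
  then have "real n < 2 ^ ?E" by (metis of_nat_less_iff of_nat_numeral of_nat_power)
  then have "ln (real n) < ln (2 ^ ?E)" using \<open>0 < n\<close> by (subst ln_less_cancel_iff) auto
  also have "\<dots> = real ?E * ln 2" by (simp add: ln_realpow)
  also have "\<dots> \<le> real ?E * 1" using ln_2_less_1 by (intro mult_left_mono) auto
  also have "real ?E * 1 \<le> real ((2 * (d + 1) * ?m) ^ 2)"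
  proof -
    have "?E \<le> (d + 1) * ((2 * ?m) * ((d + 1) * ?m))"
      using \<open>?m > 0\<close> by (intro mult_le_mono) auto
    also have "\<dots> \<le> 2 * ((d + 1) * ((2 * ?m) * ((d + 1) * ?m)))" by simp
    also have "\<dots> = (2 * (d + 1) * ?m) ^ 2" by (simp only: power2_eq_square mult_ac)
    finally show ?thesis by (simp only: mult_1_right of_nat_le_iff)
  qed
  finally show ?thesis by (intro real_le_lsqrt) auto
qed

theorem theorem1p5:
  fixes k t :: nat
  assumes "k \<ge> 3"
    and "t > 2 ^ nat \<lceil>log 2 (real k)\<rceil>"
  shows "enat_bigomega (\<lambda>n. f_shatter k n t) (\<lambda>n. sqrt (ln (real n)))"
proof -
  define d where "d = nat \<lceil>log 2 (real k)\<rceil>"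
  have "log 2 (real k) \<le> real d" unfolding d_def by linarith
  then have "real k \<le> 2 powr real d" using \<open>k \<ge> 3\<close> by (simp add: log_le_iff)
  then have "real k \<le> real (2 ^ d)" by (simp add: powr_realpow)
  then have k: "k \<le> 2 ^ d" by (simp only: of_nat_le_iff)
  have t: "2 ^ d < t" using assms(2) by (simp add: d_def)
  define c :: real where "c = 1 / (2 * (d + 1))"
  have "c > 0" by (simp add: c_def)
  moreover have "ereal (c * \<bar>sqrt (ln (real n))\<bar>) \<le> ereal_of_enat (f_shatter k n t)" if "n \<ge> k" for n
  proof (cases "shattering_families k n t = {}")
    case True
    then show ?thesis by (simp add: f_shatter_def top_enat_def)
  next
    case False
    then have "Inf ((\<lambda>P. enat (card P)) ` shattering_families k n t) \<in>
        (\<lambda>P. enat (card P)) ` shattering_families k n t"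
      by (auto intro: wellorder_InfI)
    then obtain P where P: "P \<in> shattering_families k n t" "f_shatter k n t = enat (card P)"
      unfolding f_shatter_def by (elim imageE) simp
    have "sqrt (ln (real n)) \<le> 2 * (d + 1) * card P"
      using shattering_family_bound[OF P(1) k t that] that \<open>k \<ge> 3\<close> by simp
    moreover have "0 \<le> sqrt (ln (real n))" using that \<open>k \<ge> 3\<close> by simp
    ultimately have "c * \<bar>sqrt (ln (real n))\<bar> \<le> card P"
      by (simp add: c_def field_simps)
    then show ?thesis by (simp add: P(2))
  qed
  ultimately show ?thesis
    unfolding enat_bigomega_def eventually_sequentially by blast
qed

end
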